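(* Let $\mu:\mathcal P(\mathbb N)\to[0,1]$ be a finitely additive probability measure on $\mathbb N$ and let $f\in\ell_\infty^*$ be the corresponding functional, i.e. the unique continuous linear functional on $\ell_\infty$ with $f(\chi_A)=\mu(A)$ for every $A\subseteq\mathbb N$. Then $\mu$ is a density measure if and only if $f$ extends the Ces\`aro mean, i.e. $f(x)=C(x)$ for every $x\in\mathrm{Ces}$.
   Context: $\mathbb N=\{1,2,3,\dots\}$. For $A\subseteq\mathbb N$ let $A(n)=|A\cap\{1,\dots,n\}|$; $A$ has asymptotic density $d(A)=\lim_{n\to\infty}A(n)/n$ if this limit exists. A finitely additive measure $\mu:\mathcal P(\mathbb N)\to[0,1]$ (with $\mu(\mathbb N)=1$) is a density measure if $\mu(A)=d(A)$ for every $A$ possessing asymptotic density. $\chi_A$ denotes the characteristic sequence of $A$. For a bounded sequence $x$, the Ces\`aro mean is $C(x)=\lim_{n\to\infty}(x_1+\dots+x_n)/n$ when it exists; $\mathrm{Ces}$ is the set of bounded sequences having a Ces\`aro mean. *)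

theory Defs
  imports "HOL-Analysis.Analysis"
begin

text \<open>
  The index set \<open>{1, 2, 3, \<dots>}\<close> is a type of its own, with the discrete topology. Every
  sequence on it is then continuous, so \<open>pnat \<Rightarrow>\<^sub>C real\<close> is the space of all bounded
  real sequences with the supremum norm, and its dual is the type of bounded linear functions
  \<open>(pnat \<Rightarrow>\<^sub>C real) \<Rightarrow>\<^sub>L real\<close>.
\<close>

typedef pnat = "{n::nat. 1 \<le> n}"
  morphisms nat_of_pnat pnat_of_nat
  by auto

instantiation pnat :: discrete_topology
begin

definition open_pnat :: "pnat set \<Rightarrow> bool"
  where "open_pnat A \<longleftrightarrow> True"

instance
  by standard (simp_all add: open_pnat_def)

end

type_synonym l_infty = "pnat \<Rightarrow>\<^sub>C real"

text \<open>The initial segment \<open>{1, \<dots>, n}\<close>; it is empty for \<open>n = 0\<close>.\<close>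

definition upto_pnat :: "nat \<Rightarrow> pnat set"
  where "upto_pnat n = {k. nat_of_pnat k \<le> n}"

lemma image_upto_pnat: "nat_of_pnat ` upto_pnat n = {1..n}"
proof (intro set_eqI iffI)
  fix m assume "m \<in> nat_of_pnat ` upto_pnat n"
  then show "m \<in> {1..n}"
    using nat_of_pnat by (auto simp: upto_pnat_def)
next
  fix m assume "m \<in> {1..n}"
  then have "nat_of_pnat (pnat_of_nat m) = m" "m \<le> n"
    by (auto intro: pnat_of_nat_inverse)
  then show "m \<in> nat_of_pnat ` upto_pnat n"
    unfolding upto_pnat_def by (metis image_eqI mem_Collect_eq)
qed

lemma finite_upto_pnat: "finite (upto_pnat n)"
  by (rule finite_imageD[of nat_of_pnat]) (auto simp: image_upto_pnat inj_on_def nat_of_pnat_inject)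

lemma card_upto_pnat: "card (upto_pnat n) = n"
  using card_image[of nat_of_pnat "upto_pnat n"]
  by (simp add: image_upto_pnat inj_on_def nat_of_pnat_inject)

definition counting :: "pnat set \<Rightarrow> nat \<Rightarrow> nat"
  where "counting A n = card (A \<inter> upto_pnat n)"

text \<open>
  The quotients below are taken for all \<open>n\<close> including \<open>0\<close>, where they are \<open>0 / 0 = 0\<close>; this does
  not affect the limits.
\<close>

definition has_asymptotic_density :: "pnat set \<Rightarrow> bool"
  where "has_asymptotic_density A \<longleftrightarrow> convergent (\<lambda>n. real (counting A n) / real n)"

definition asymptotic_density :: "pnat set \<Rightarrow> real"
  where "asymptotic_density A = lim (\<lambda>n. real (counting A n) / real n)"

definition fin_additive_prob :: "(pnat set \<Rightarrow> real) \<Rightarrow> bool"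
  where "fin_additive_prob \<mu> \<longleftrightarrow> range \<mu> \<subseteq> {0..1} \<and> additive UNIV \<mu> \<and> \<mu> UNIV = 1"

definition density_measure :: "(pnat set \<Rightarrow> real) \<Rightarrow> bool"
  where "density_measure \<mu> \<longleftrightarrow> fin_additive_prob \<mu> \<and>
    (\<forall>A. has_asymptotic_density A \<longrightarrow> \<mu> A = asymptotic_density A)"

definition char_seq :: "pnat set \<Rightarrow> l_infty"
  where "char_seq A = Bcontfun (indicat_real A)"

lemma apply_char_seq: "apply_bcontfun (char_seq A) = indicat_real A"
proof -
  have "continuous_on UNIV (indicat_real A)"
    by (simp add: continuous_on_open_vimage open_discrete)
  moreover have "bounded (range (indicat_real A))"
    by (rule finite_imp_bounded, rule finite_subset[of _ "{0, 1}"]) (auto simp: indicator_def)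
  ultimately have "indicat_real A \<in> bcontfun"
    by (simp add: bcontfun_def)
  then show ?thesis
    by (simp add: char_seq_def Bcontfun_inverse)
qed

definition averages :: "l_infty \<Rightarrow> nat \<Rightarrow> real"
  where "averages x n = (\<Sum>k\<in>upto_pnat n. x k) / real n"

definition Ces :: "l_infty set"
  where "Ces = {x. convergent (averages x)}"

definition cesaro_mean :: "l_infty \<Rightarrow> real"
  where "cesaro_mean x = lim (averages x)"

end

theory Submission
  imports Defs
begin

text \<open>
  A real sequence \<open>x\<close> with values in \<open>[0, 1]\<close> and partial sums \<open>X\<close> is rounded to the set \<open>A\<close> of
  all \<open>n\<close> at which \<open>\<lfloor>X\<rfloor>\<close> jumps. Then \<open>A\<close> counts \<open>\<lfloor>X n\<rfloor>\<close> elements up to \<open>n\<close>, so its density is the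
  mean of \<open>x\<close>, and \<open>x - \<chi>\<^sub>A = s - T s\<close>, where \<open>s\<close> is the fractional part of \<open>X\<close> and \<open>T\<close> the
  right shift. It remains to see that \<open>f s = f (T s)\<close>; by uniform approximation of \<open>s\<close> by averages
  of its superlevel sets this is the shift invariance of the density measure \<open>\<mu>\<close>. For the latter,
  the points where a set \<open>A\<close> is entered and left alternate, so the sets \<open>B\<close> and \<open>C\<close> of such
  points can be completed, by the same set \<open>D\<close> of every other remaining point, to sets of
  density \<open>1/2\<close>; therefore \<open>\<mu> B = \<mu> C\<close>.
\<close>

section \<open>Counting functions and their limits\<close>

lemma sum_upto_pnat: "(\<Sum>k\<in>upto_pnat n. g (nat_of_pnat k)) = sum g {1..n}"
proof -
  have "sum g (nat_of_pnat ` upto_pnat n) = (\<Sum>k\<in>upto_pnat n. g (nat_of_pnat k))"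
    by (rule sum.reindex_cong[OF _ refl refl]) (auto simp: inj_on_def nat_of_pnat_inject)
  then show ?thesis
    by (simp add: image_upto_pnat)
qed

lemma nat_of_pnat_ge_1: "1 \<le> nat_of_pnat k"
  using nat_of_pnat by auto

lemma counting_eq_sum: "real (counting A n) = (\<Sum>k\<in>upto_pnat n. indicat_real A k)"
  by (simp add: counting_def finite_upto_pnat Int_commute sum_of_bool_eq indicator_def)

text \<open>Moves counting to sums over \<open>{1..n}\<close>, where induction on \<open>n\<close>
  is available.\<close>

lemma counting_Collect:
  "real (counting {k. P (nat_of_pnat k)} n) = (\<Sum>i=1..n. of_bool (P i))"
proof -
  have "real (counting {k. P (nat_of_pnat k)} n) = (\<Sum>k\<in>upto_pnat n. of_bool (P (nat_of_pnat k)))"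
    unfolding counting_eq_sum by (intro sum.cong) (auto simp: indicator_def)
  then show ?thesis
    using sum_upto_pnat[of "\<lambda>i. of_bool (P i)" n] by (rule trans)
qed

lemma counting_Un:
  assumes "A \<inter> B = {}"
  shows "counting (A \<union> B) n = counting A n + counting B n"
proof -
  have "(A \<union> B) \<inter> upto_pnat n = (A \<inter> upto_pnat n) \<union> (B \<inter> upto_pnat n)"
    by auto
  then show ?thesis
    unfolding counting_def using assms
    by (simp add: card_Un_disjoint disjoint_iff finite_upto_pnat)
qed

lemma averages_char_seq: "averages (char_seq A) n = real (counting A n) / real n"
  by (simp only: averages_def apply_char_seq counting_eq_sum)

lemma density_measure_eq:
  assumes "density_measure \<mu>" and "(\<lambda>n. real (counting A n) / real n) \<longlonglongrightarrow> c"
  shows "\<mu> A = c"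
proof -
  have "has_asymptotic_density A"
    using assms(2) by (auto simp: has_asymptotic_density_def convergent_def)
  then have "\<mu> A = asymptotic_density A"
    using assms(1) by (simp add: density_measure_def)
  then show ?thesis
    using assms(2) by (simp add: asymptotic_density_def limI)
qed

lemma fin_additive_prob_Un:
  assumes "fin_additive_prob \<mu>" and "A \<inter> B = {}"
  shows "\<mu> (A \<union> B) = \<mu> A + \<mu> B"
  using assms by (simp add: fin_additive_prob_def additive_def)

text \<open>Division by \<open>n\<close> wipes out a bounded error, so rounding the counts leaves
  the densities unchanged.\<close>

lemma tendsto_div_of_bounded_diff:
  fixes a b :: "nat \<Rightarrow> real"
  assumes b: "(\<lambda>n. b n / real n) \<longlonglongrightarrow> c" and bd: "\<And>n. \<bar>a n - b n\<bar> \<le> K"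
  shows "(\<lambda>n. a n / real n) \<longlonglongrightarrow> c"
proof -
  have "(\<lambda>n. (a n - b n) / real n) \<longlonglongrightarrow> 0"
  proof (rule Lim_null_comparison)
    show "\<forall>\<^sub>F n in sequentially. norm ((a n - b n) / real n) \<le> K / real n"
      using bd by (intro always_eventually) (simp add: divide_right_mono)
    show "(\<lambda>n. K / real n) \<longlonglongrightarrow> 0"
      by (rule lim_const_over_n)
  qed
  from tendsto_add[OF this b] show ?thesis
    by (simp add: add_divide_distrib[symmetric])
qed

section \<open>Rounding to a set; shift invariance of the measure\<close>

definition jumps :: "(nat \<Rightarrow> real) \<Rightarrow> nat \<Rightarrow> bool"
  where "jumps w n \<longleftrightarrow> \<lfloor>\<Sum>i=1..n - 1. w i\<rfloor> < \<lfloor>\<Sum>i=1..n. w i\<rfloor>"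

text \<open>A summand between 0 and 1 raises the floor of the partial sum by 0 or 1.\<close>

lemma of_bool_jumps:
  assumes "1 \<le> n" and "0 \<le> w n" and "w n \<le> 1"
  shows "of_bool (jumps w n) = real_of_int \<lfloor>\<Sum>i=1..n. w i\<rfloor> - real_of_int \<lfloor>\<Sum>i=1..n - 1. w i\<rfloor>"
proof -
  have "(\<Sum>i=1..n. w i) = (\<Sum>i=1..n - 1. w i) + w n"
    using assms(1) by (cases n) simp_all
  then have "\<lfloor>\<Sum>i=1..n. w i\<rfloor> = \<lfloor>\<Sum>i=1..n - 1. w i\<rfloor> \<or> \<lfloor>\<Sum>i=1..n. w i\<rfloor> = \<lfloor>\<Sum>i=1..n - 1. w i\<rfloor> + 1"
    using assms(2,3) by linarith
  then show ?thesis
    by (auto simp: jumps_def)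
qed

lemma sum_jumps:
  assumes "\<And>i. 0 \<le> w i" and "\<And>i. w i \<le> 1"
  shows "(\<Sum>i=1..n. of_bool (jumps w i)) = real_of_int \<lfloor>\<Sum>i=1..n. w i\<rfloor>"
proof (induction n)
  case (Suc n)
  show ?case
    using Suc of_bool_jumps[of "Suc n" w] assms by simp
qed simp

text \<open>Where \<open>w\<close> vanishes the partial sum stands still; at 0 truncated subtraction
  makes both sums empty. Weight 0 thus keeps a point out of the rounded set.\<close>

lemma jumps_imp_nonzero: "jumps w n \<Longrightarrow> w n \<noteq> 0"
  by (cases n) (auto simp: jumps_def)

text \<open>Both sets share \<open>E\<close>; what remains is \<open>B\<close> in one and
  \<open>C\<close> in the other, so \<open>\<mu> B = \<mu> C\<close> suffices. By
  \<open>\<not> P 0\<close> the first run is entered inside the index set, so every exit has its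
  entry.\<close>

lemma density_measure_shift:
  assumes \<mu>: "density_measure \<mu>" and P0: "\<not> P 0"
  shows "\<mu> {k. P (nat_of_pnat k)} = \<mu> {k. P (nat_of_pnat k - 1)}"
proof -
  define b where "b i \<longleftrightarrow> P i \<and> \<not> P (i - 1)" for i
  define c where "c i \<longleftrightarrow> \<not> P i \<and> P (i - 1)" for i
  \<comment> \<open>Weight 1/2 makes the rounded set \<open>D\<close> take every other point outside
    \<open>B\<close> and \<open>C\<close>; weight 0 keeps it off both.\<close>
  define w :: "nat \<Rightarrow> real" where "w i = (if b i \<or> c i then 0 else 1/2)" for i
  define B where "B = {k. b (nat_of_pnat k)}"
  define C where "C = {k. c (nat_of_pnat k)}"
  define D where "D = {k. jumps w (nat_of_pnat k)}"
  define E where "E = {k. P (nat_of_pnat k) \<and> P (nat_of_pnat k - 1)}"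
  have add: "\<And>X Y. X \<inter> Y = {} \<Longrightarrow> \<mu> (X \<union> Y) = \<mu> X + \<mu> Y"
    using \<mu> by (auto simp: density_measure_def fin_additive_prob_Un)
  \<comment> \<open>Entries minus exits telescope, starting from \<open>\<not> P 0\<close>.\<close>
  have BC: "real (counting B n) - real (counting C n) = of_bool (P n)" for n
    unfolding B_def C_def counting_Collect
    by (induction n) (use P0 in \<open>auto simp: b_def c_def\<close>)
  have w_sum: "2 * (\<Sum>i=1..n. w i) = real n - real (counting B n) - real (counting C n)" for n
    unfolding B_def C_def counting_Collect
    by (induction n) (auto simp: w_def b_def c_def)
  have D: "real (counting D n) = \<lfloor>\<Sum>i=1..n. w i\<rfloor>" for n
    unfolding D_def counting_Collect by (rule sum_jumps) (auto simp: w_def)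
  have disj: "B \<inter> D = {}" "C \<inter> D = {}"
    by (auto simp: B_def C_def D_def w_def dest!: jumps_imp_nonzero)
  have half: "(\<lambda>n. real n / 2 / real n) \<longlonglongrightarrow> 1/2"
    by (rule tendsto_eventually) (auto intro: eventually_mono[OF eventually_gt_at_top[of 0]])
  have "\<mu> (B \<union> D) = 1/2"
  proof (rule density_measure_eq[OF \<mu>], rule tendsto_div_of_bounded_diff[OF half])
    \<comment> \<open>The deviation is half of \<open>of_bool (P n)\<close> minus a fractional part;
      for \<open>C\<close> below, that half changes sign. The bound 2 covers both.\<close>
    show "\<bar>real (counting (B \<union> D) n) - real n / 2\<bar> \<le> 2" for n
      using BC[of n] w_sum[of n] D[of n] counting_Un[OF disj(1), of n]
      by (cases "P n"; simp) linarith+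
  qed
  moreover have "\<mu> (C \<union> D) = 1/2"
  proof (rule density_measure_eq[OF \<mu>], rule tendsto_div_of_bounded_diff[OF half])
    show "\<bar>real (counting (C \<union> D) n) - real n / 2\<bar> \<le> 2" for n
      using BC[of n] w_sum[of n] D[of n] counting_Un[OF disj(2), of n]
      by (cases "P n"; simp) linarith+
  qed
  ultimately have "\<mu> B = \<mu> C"
    using add disj by simp
  moreover have "{k. P (nat_of_pnat k)} = B \<union> E" "B \<inter> E = {}"
    "{k. P (nat_of_pnat k - 1)} = C \<union> E" "C \<inter> E = {}"
    by (auto simp: B_def C_def E_def b_def c_def)
  ultimately show ?thesis
    using add by simp
qed

section \<open>Uniform approximation; shift invariance of the functional\<close>

lemma apply_Bcontfun_pnat:
  fixes u :: "pnat \<Rightarrow> real"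
  assumes "\<And>k. \<bar>u k\<bar> \<le> K"
  shows "apply_bcontfun (Bcontfun u) = u"
proof -
  have "continuous_on UNIV u"
    by (simp add: continuous_on_open_vimage open_discrete)
  moreover have "bounded (range u)"
    using assms by (auto simp: bounded_iff)
  ultimately show ?thesis
    by (simp add: bcontfun_def Bcontfun_inverse)
qed

lemma apply_bcontfun_sum: "apply_bcontfun (sum g S) k = (\<Sum>j\<in>S. apply_bcontfun (g j) k)"
  by (induction S rule: infinite_finite_induct) simp_all

lemma sum_of_bool_le_floor:
  fixes t :: real
  assumes "0 \<le> t" and "t \<le> real n"
  shows "(\<Sum>j=1..n. of_bool (real j \<le> t)) = real_of_int \<lfloor>t\<rfloor>"
proof -
  have "{j \<in> {1..n}. real j \<le> t} = {1..nat \<lfloor>t\<rfloor>}"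
    using assms by (auto simp: le_nat_iff le_floor_iff)
  moreover have "(\<Sum>j=1..n. of_bool (real j \<le> t)) = real (card {j \<in> {1..n}. real j \<le> t})"
    by (simp add: of_bool_def sum.If_cases Int_def)
  ultimately show ?thesis
    using assms by simp
qed

text \<open>A point \<open>k\<close> lies in exactly \<open>\<lfloor>real n * u k\<rfloor>\<close>
  of the \<open>n\<close> superlevel sets, so their average is \<open>u k\<close> rounded down to a
  multiple of \<open>1 / n\<close>.\<close>

lemma norm_diff_superlevel_average:
  fixes u :: l_infty
  assumes "\<And>k. 0 \<le> u k" and "\<And>k. u k \<le> 1" and n: "0 < n"
  shows "norm (u - (1 / real n) *\<^sub>R (\<Sum>j=1..n. char_seq {k. real j / real n \<le> u k})) \<le> 1 / real n"
proof (rule norm_bound)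
  fix k
  have "(\<Sum>j=1..n. indicat_real {k. real j / real n \<le> u k} k) = (\<Sum>j=1..n. of_bool (real j \<le> real n * u k))"
    using n by (intro sum.cong) (auto simp: indicator_def field_simps)
  also have "\<dots> = real_of_int \<lfloor>real n * u k\<rfloor>"
    using assms by (intro sum_of_bool_le_floor) (auto simp: mult_left_le)
  finally have eq: "(\<Sum>j=1..n. indicat_real {k. real j / real n \<le> u k} k) = \<lfloor>real n * u k\<rfloor>" .
  have "u k - real_of_int \<lfloor>real n * u k\<rfloor> / real n = (real n * u k - \<lfloor>real n * u k\<rfloor>) / real n"
    using n by (simp add: field_simps)
  moreover have "\<bar>real n * u k - \<lfloor>real n * u k\<rfloor>\<bar> \<le> 1"
    by linarith
  ultimately have "\<bar>u k - real_of_int \<lfloor>real n * u k\<rfloor> / real n\<bar> \<le> 1 / real n"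
    by (simp add: divide_right_mono)
  then show "norm (apply_bcontfun (u - (1 / real n) *\<^sub>R (\<Sum>j=1..n. char_seq {k. real j / real n \<le> u k})) k)
      \<le> 1 / real n"
    by (simp add: apply_bcontfun_sum apply_char_seq eq del: One_nat_def)
qed

text \<open>The approximating averages of \<open>u\<close> and \<open>v\<close> have equal images
  under \<open>f\<close>, and each error is at most \<open>norm f / n\<close>. Only heights
  \<open>j / n\<close> with positive \<open>j\<close> occur, which is why \<open>eq\<close> speaks
  of positive \<open>t\<close>.\<close>

lemma blinfun_eq_if_superlevel_eq:
  fixes f :: "l_infty \<Rightarrow>\<^sub>L real" and u v :: l_infty
  assumes u: "\<And>k. 0 \<le> u k" "\<And>k. u k \<le> 1" and v: "\<And>k. 0 \<le> v k" "\<And>k. v k \<le> 1"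
    and eq: "\<And>t. 0 < t \<Longrightarrow> f (char_seq {k. t \<le> u k}) = f (char_seq {k. t \<le> v k})"
  shows "f u = f v"
proof -
  have bd: "\<bar>f u - f v\<bar> \<le> 2 * norm f / real n" if n: "0 < n" for n :: nat
  proof -
    define a where "a u = (1 / real n) *\<^sub>R (\<Sum>j=1..n. char_seq {k. real j / real n \<le> apply_bcontfun u k})" for u
    have "(\<Sum>j=1..n. f (char_seq {k. real j / real n \<le> u k})) = (\<Sum>j=1..n. f (char_seq {k. real j / real n \<le> v k}))"
      using n by (intro sum.cong eq) auto
    then have "f (a u) = f (a v)"
      by (simp add: a_def blinfun.scaleR_right blinfun.sum_right)
    moreover have "\<bar>f u - f (a u)\<bar> \<le> norm f * (1 / real n)"
      using norm_blinfun[of f "u - a u"] norm_diff_superlevel_average[OF u n]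
      by (simp only: a_def blinfun.diff_right real_norm_def)
        (meson mult_left_mono norm_ge_zero order_trans)
    moreover have "\<bar>f v - f (a v)\<bar> \<le> norm f * (1 / real n)"
      using norm_blinfun[of f "v - a v"] norm_diff_superlevel_average[OF v n]
      by (simp only: a_def blinfun.diff_right real_norm_def)
        (meson mult_left_mono norm_ge_zero order_trans)
    ultimately show ?thesis
      by simp
  qed
  have "\<bar>f u - f v\<bar> \<le> 0"
  proof (rule tendsto_lowerbound[OF lim_const_over_n])
    show "\<forall>\<^sub>F n in sequentially. \<bar>f u - f v\<bar> \<le> 2 * norm f / real n"
      using eventually_gt_at_top[of 0] by eventually_elim (rule bd)
  qed simp
  then show ?thesis
    by simp
qed

text \<open>Shifting commutes with taking superlevel sets, so shift invariance of
  \<open>\<mu>\<close> applies at every height. As \<open>s 0 = 0\<close>, the predicate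
  \<open>t \<le> s n\<close> fails at 0 for positive \<open>t\<close>.\<close>

lemma density_measure_functional_shift:
  fixes f :: "l_infty \<Rightarrow>\<^sub>L real" and s :: "nat \<Rightarrow> real"
  assumes \<mu>: "density_measure \<mu>" and f: "\<And>A. f (char_seq A) = \<mu> A"
    and s: "\<And>n. 0 \<le> s n" "\<And>n. s n \<le> 1" "s 0 = 0"
  shows "f (Bcontfun (\<lambda>k. s (nat_of_pnat k))) = f (Bcontfun (\<lambda>k. s (nat_of_pnat k - 1)))"
proof -
  have ap: "apply_bcontfun (Bcontfun (\<lambda>k. s (nat_of_pnat k))) = (\<lambda>k. s (nat_of_pnat k))"
    "apply_bcontfun (Bcontfun (\<lambda>k. s (nat_of_pnat k - 1))) = (\<lambda>k. s (nat_of_pnat k - 1))"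
    using s by (auto intro!: apply_Bcontfun_pnat[of _ 1])
  show ?thesis
  proof (rule blinfun_eq_if_superlevel_eq)
    fix t :: real assume "0 < t"
    then show "f (char_seq {k. t \<le> Bcontfun (\<lambda>k. s (nat_of_pnat k)) k})
        = f (char_seq {k. t \<le> Bcontfun (\<lambda>k. s (nat_of_pnat k - 1)) k})"
      unfolding ap f using density_measure_shift[OF \<mu>, of "\<lambda>n. t \<le> s n"] s(3) by simp
  qed (simp_all only: ap s)
qed

section \<open>Agreement with the Cesaro mean\<close>

lemma functional_eq_mean_unit_interval:
  fixes f :: "l_infty \<Rightarrow>\<^sub>L real" and x :: l_infty
  assumes \<mu>: "density_measure \<mu>" and f: "\<And>A. f (char_seq A) = \<mu> A"
    and x: "\<And>k. 0 \<le> x k" "\<And>k. x k \<le> 1" and lim: "averages x \<longlonglongrightarrow> c"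
  shows "f x = c"
proof -
  \<comment> \<open>Index 0 enters no partial sum; the default 0 keeps \<open>w\<close> within its
    bounds for all \<open>n\<close>.\<close>
  define w where "w n = (if 1 \<le> n then x (pnat_of_nat n) else 0)" for n
  have w: "0 \<le> w n" "w n \<le> 1" for n
    using x by (auto simp: w_def)
  have xw: "apply_bcontfun x k = w (nat_of_pnat k)" for k
    using nat_of_pnat_ge_1[of k] by (simp add: w_def nat_of_pnat_inverse)
  define A where "A = {k. jumps w (nat_of_pnat k)}"
  define s where "s n = frac (\<Sum>i=1..n. w i)" for n
  define S where "S = Bcontfun (\<lambda>k. s (nat_of_pnat k))"
  define T where "T = Bcontfun (\<lambda>k. s (nat_of_pnat k - 1))"
  have s: "0 \<le> s n" "s n \<le> 1" "s 0 = 0" for n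
    by (simp_all add: s_def frac_lt_1 less_imp_le)
  have ap: "apply_bcontfun S = (\<lambda>k. s (nat_of_pnat k))" "apply_bcontfun T = (\<lambda>k. s (nat_of_pnat k - 1))"
    unfolding S_def T_def using s by (auto intro!: apply_Bcontfun_pnat[of _ 1])
  \<comment> \<open>Each term is a difference of consecutive partial sums: the integer parts give
    the jump, the fractional parts give \<open>S - T\<close>.\<close>
  have "x = char_seq A + (S - T)"
  proof (rule bcontfun_eqI)
    fix k
    obtain m where m: "nat_of_pnat k = Suc m"
      using nat_of_pnat_ge_1[of k] by (cases "nat_of_pnat k") auto
    have "indicat_real A k = of_bool (jumps w (Suc m))"
      by (simp add: A_def indicator_def m)
    then show "apply_bcontfun x k = apply_bcontfun (char_seq A + (S - T)) k"
      using of_bool_jumps[of "Suc m" w] w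
      by (simp add: apply_char_seq ap xw m s_def frac_def)
  qed
  moreover have "f S = f T"
    unfolding S_def T_def by (rule density_measure_functional_shift[where s = s, OF \<mu> f s])
  ultimately have "f x = \<mu> A"
    by (simp add: blinfun.add_right blinfun.diff_right f)
  also have "\<mu> A = c"
  proof (rule density_measure_eq[OF \<mu>], rule tendsto_div_of_bounded_diff)
    show "(\<lambda>n. (\<Sum>i=1..n. w i) / real n) \<longlonglongrightarrow> c"
      using lim by (simp add: averages_def[abs_def] xw sum_upto_pnat)
    show "\<bar>real (counting A n) - (\<Sum>i=1..n. w i)\<bar> \<le> 1" for n
      unfolding A_def counting_Collect sum_jumps[of w, OF w] by linarith
  qed
  finally show ?thesis .
qed

text \<open>An affine rescaling reduces to values in \<open>[0, 1]\<close>: \<open>f\<close> and the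
  Cesaro mean are linear and both give 1 on the constant sequence
  \<open>char_seq UNIV\<close>.\<close>

lemma functional_eq_mean:
  fixes f :: "l_infty \<Rightarrow>\<^sub>L real" and x :: l_infty
  assumes \<mu>: "density_measure \<mu>" and f: "\<And>A. f (char_seq A) = \<mu> A"
    and lim: "averages x \<longlonglongrightarrow> c"
  shows "f x = c"
proof -
  \<comment> \<open>Adding 1 keeps \<open>M\<close> positive even for the zero sequence, so dividing
    by \<open>2 * M\<close> is safe.\<close>
  define M where "M = norm x + 1"
  have M: "0 < M" and xM: "\<bar>x k\<bar> \<le> M" for k
    using norm_bounded[of x k] by (auto simp: M_def add_nonneg_pos)
  define y where "y = (1 / (2 * M)) *\<^sub>R (x + M *\<^sub>R char_seq UNIV)"
  have y: "apply_bcontfun y k = (x k + M) / (2 * M)" for k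
    by (simp add: y_def apply_char_seq)
  have fU: "f (char_seq UNIV) = 1"
    using \<mu> f by (simp add: density_measure_def fin_additive_prob_def)
  have "f y = (c + M) / (2 * M)"
  proof (rule functional_eq_mean_unit_interval[OF \<mu> f])
    show "0 \<le> y k" "y k \<le> 1" for k
      using xM[of k] M by (auto simp: y)
    have "(\<lambda>n. (averages x n + M) / (2 * M)) \<longlonglongrightarrow> (c + M) / (2 * M)"
      using M by (intro tendsto_intros lim) simp
    \<comment> \<open>At \<open>n = 0\<close> the identity fails, since both averages are 0
      there.\<close>
    moreover have "\<forall>\<^sub>F n in sequentially. (averages x n + M) / (2 * M) = averages y n"
      using eventually_gt_at_top[of 0]
    proof eventually_elim
      case (elim n)
      have "(\<Sum>k\<in>upto_pnat n. y k) = ((\<Sum>k\<in>upto_pnat n. x k) + real n * M) / (2 * M)"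
        by (simp add: y sum_divide_distrib[symmetric] sum.distrib card_upto_pnat)
      then show ?case
        using elim M by (simp add: averages_def add_divide_distrib)
    qed
    ultimately show "averages y \<longlonglongrightarrow> (c + M) / (2 * M)"
      by (rule Lim_transform_eventually)
  qed
  moreover have "f y = (f x + M) / (2 * M)"
    by (simp add: y_def blinfun.scaleR_right blinfun.add_right fU)
  ultimately show ?thesis
    using M by simp
qed

theorem theorem3p3:
  fixes \<mu> :: "pnat set \<Rightarrow> real"
    and f :: "l_infty \<Rightarrow>\<^sub>L real"
  assumes "fin_additive_prob \<mu>"
    and "\<And>A. blinfun_apply f (char_seq A) = \<mu> A"
  shows "density_measure \<mu> \<longleftrightarrow> (\<forall>x\<in>Ces. blinfun_apply f x = cesaro_mean x)"
proof
  assume \<mu>: "density_measure \<mu>"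
  show "\<forall>x\<in>Ces. f x = cesaro_mean x"
  proof
    fix x assume "x \<in> Ces"
    then have "averages x \<longlonglongrightarrow> cesaro_mean x"
      by (simp add: Ces_def cesaro_mean_def convergent_LIMSEQ_iff)
    then show "f x = cesaro_mean x"
      by (rule functional_eq_mean[OF \<mu> assms(2)])
  qed
next
  assume f: "\<forall>x\<in>Ces. f x = cesaro_mean x"
  \<comment> \<open>The averages of \<open>char_seq A\<close> are the density quotients, so density
    is a special case of the Cesaro mean.\<close>
  have av: "averages (char_seq A) = (\<lambda>n. real (counting A n) / real n)" for A
    by (rule ext) (rule averages_char_seq)
  have "\<mu> A = asymptotic_density A" if "has_asymptotic_density A" for A
    using f[rule_format, of "char_seq A"] that assms(2)[of A]
    by (simp add: Ces_def cesaro_mean_def has_asymptotic_density_def asymptotic_density_def av)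
  then show "density_measure \<mu>"
    using assms(1) by (simp add: density_measure_def)
qed

end
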